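(* For every fixed integer $d\ge2$, as $\delta\downarrow0$, \[ B_{[]}^{\rm sh}(d,\delta)=(1+o_d(1))\delta^{-d},\qquad B_{\rm cov}^{\rm sh}(d,\delta)=(1+o_d(1))\delta^{-d}. \]
   Context: For given $d\in\mathbb N$, $0<\delta<1$, define recursively $L_0=0$, $c_i:=\log(1+\delta e^{L_i})$, $L_{i+1}:=\min\{L_i+c_i/\sqrt{d\delta},\ d\log(\delta^{-1})\}$, and let $J$ be the first index with $L_J=d\log(\delta^{-1})$ (it exists). For $0\le i<J$ put \[ r_i^-:=\max\Bigl\{0,\Bigl\lceil d\Bigl(\frac{L_i}{c_i}-1\Bigr)\Bigr\rceil\Bigr\},\qquad r_i^+:=\Bigl\lceil\frac{dL_{i+1}}{c_i}\Bigr\rceil-1, \] $\mathcal A_i:=\{\boldsymbol n\in\mathbb N_0^d: r_i^-\le\sum_{j=1}^dn_j\le r_i^+\}$, $\boldsymbol 1=(1,\dots,1)$, and \[ B_{[]}^{\rm sh}(d,\delta):=d+\sum_{i=0}^{J-1}|\mathcal A_i|,\qquad B_{\rm cov}^{\rm sh}(d,\delta):=d+\sum_{i=0}^{J-1}|\mathcal A_i\cup(\mathcal A_i+\boldsymbol1)| . \] $o_d(1)$ denotes a quantity tending to $0$ as $\delta\downarrow0$ with $d$ fixed. *)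

theory Defs
  imports "HOL-Analysis.Analysis"
begin

primrec sh_L :: "nat \<Rightarrow> real \<Rightarrow> nat \<Rightarrow> real" where
  "sh_L d \<delta> 0 = 0"
| "sh_L d \<delta> (Suc i) =
     min (sh_L d \<delta> i + ln (1 + \<delta> * exp (sh_L d \<delta> i)) / sqrt (real d * \<delta>))
         (real d * ln (inverse \<delta>))"

definition sh_c :: "nat \<Rightarrow> real \<Rightarrow> nat \<Rightarrow> real" where
  "sh_c d \<delta> i = ln (1 + \<delta> * exp (sh_L d \<delta> i))"

lemma sh_L_Suc:
  "sh_L d \<delta> (Suc i) = min (sh_L d \<delta> i + sh_c d \<delta> i / sqrt (real d * \<delta>)) (real d * ln (inverse \<delta>))"
  by (simp add: sh_c_def)

(* The minimum exists whenever d \<ge> 1 and 0 < \<delta> < 1; see sh_J_exists below. *)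
definition sh_J :: "nat \<Rightarrow> real \<Rightarrow> nat" where
  "sh_J d \<delta> = (LEAST j. sh_L d \<delta> j = real d * ln (inverse \<delta>))"

(* The ranks are integers, so that the "- 1" in the upper one is not truncated. *)
definition sh_r_minus :: "nat \<Rightarrow> real \<Rightarrow> nat \<Rightarrow> int" where
  "sh_r_minus d \<delta> i = max 0 \<lceil>real d * (sh_L d \<delta> i / sh_c d \<delta> i - 1)\<rceil>"

definition sh_r_plus :: "nat \<Rightarrow> real \<Rightarrow> nat \<Rightarrow> int" where
  "sh_r_plus d \<delta> i = \<lceil>real d * sh_L d \<delta> (Suc i) / sh_c d \<delta> i\<rceil> - 1"

(* Multi-indices with d nonnegative integer entries are lists of length d;
   adding the all-ones vector is then map Suc. *)
definition sh_A :: "nat \<Rightarrow> real \<Rightarrow> nat \<Rightarrow> nat list set" where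
  "sh_A d \<delta> i = {n. length n = d \<and>
     sh_r_minus d \<delta> i \<le> int (sum_list n) \<and> int (sum_list n) \<le> sh_r_plus d \<delta> i}"

definition B_bracket_sh :: "nat \<Rightarrow> real \<Rightarrow> nat" where
  "B_bracket_sh d \<delta> = d + (\<Sum>i<sh_J d \<delta>. card (sh_A d \<delta> i))"

definition B_cov_sh :: "nat \<Rightarrow> real \<Rightarrow> nat" where
  "B_cov_sh d \<delta> = d + (\<Sum>i<sh_J d \<delta>. card (sh_A d \<delta> i \<union> map Suc ` sh_A d \<delta> i))"

lemma finite_sh_A: "finite (sh_A d \<delta> i)"
proof (rule finite_subset)
  show "sh_A d \<delta> i \<subseteq> {n. set n \<subseteq> {..nat (sh_r_plus d \<delta> i)} \<and> length n = d}"
    using member_le_sum_list by (fastforce simp: sh_A_def)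
qed (simp add: finite_lists_length_eq)

lemma sh_J_exists:
  assumes "d \<ge> 1" "0 < \<delta>" "\<delta> < 1"
  shows "\<exists>j. sh_L d \<delta> j = real d * ln (inverse \<delta>)"
proof -
  define T where "T = real d * ln (inverse \<delta>)"
  define s where "s = ln (1 + \<delta>) / sqrt (real d * \<delta>)"
  have T: "T \<ge> 0" using assms by (simp add: T_def one_le_inverse_iff)
  have s: "s > 0" using assms by (simp add: s_def)
  have lower: "min (real i * s) T \<le> sh_L d \<delta> i" for i
  proof (induction i)
    case 0
    then show ?case by simp
  next
    case (Suc i)
    have nonneg: "0 \<le> sh_L d \<delta> i"
      using Suc T s by (smt (verit) mult_nonneg_nonneg of_nat_0_le_iff)
    have "ln (1 + \<delta>) \<le> sh_c d \<delta> i"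
      using assms nonneg by (simp add: sh_c_def add_pos_pos)
    then have "s \<le> sh_c d \<delta> i / sqrt (real d * \<delta>)"
      using assms by (simp add: s_def divide_right_mono)
    moreover have "real (Suc i) * s = real i * s + s"
      by (simp add: algebra_simps)
    ultimately show ?case
      using Suc T s unfolding sh_L_Suc T_def[symmetric] by linarith
  qed
  have upper: "sh_L d \<delta> i \<le> T" for i
    using T by (cases i) (auto simp: T_def)
  obtain n :: nat where "T < real n * s"
    using s reals_Archimedean3 by blast
  then have "sh_L d \<delta> n = T"
    using lower[of n] upper[of n] by simp
  then show ?thesis unfolding T_def by blast
qed

end

theory Submission
  imports Defs "HOL-Real_Asymp.Real_Asymp"
begin

text \<open>
  Write \<open>T = d log (1/\<delta>)\<close> and \<open>c(L) = log (1 + \<delta> e\<^sup>L)\<close>. The number of lattice points of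
  \<open>\<nat>\<^sup>d\<close> with coordinate sum below \<open>r\<close> is about \<open>r\<^sup>d / d!\<close>, so the layer of step \<open>i\<close>, whose
  sums run from about \<open>d L\<^sub>i / c\<^sub>i\<close> to about \<open>d L\<^sub>i\<^sub>+\<^sub>1 / c\<^sub>i\<close>, holds about
  \<open>(d\<^sup>d / d!) (L\<^sub>i\<^sub>+\<^sub>1\<^sup>d - L\<^sub>i\<^sup>d) / c\<^sub>i\<^sup>d\<close> points. As long as \<open>\<delta> e\<^sup>L\<close> is small, \<open>c(L)\<close> is close to
  \<open>\<delta> e\<^sup>L\<close>, and \<open>\<delta>\<^sup>d\<close> times the total is a Riemann sum for the integral of
  \<open>(d\<^sup>d / d!) d L\<^sup>d\<^sup>-\<^sup>1 e\<^sup>-\<^sup>d\<^sup>L\<close> over \<open>[0, T]\<close>. The integrand is the density of the Erlang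
  distribution with shape and rate \<open>d\<close>, hence the total mass tends to 1 as \<open>T \<rightarrow> \<infinity>\<close>.

  With the distribution function \<open>F = erlang d\<close> in closed form, each layer can be compared
  with an increment of \<open>F\<close>, and the increments telescope.

  Lower bound. Always \<open>c(L) \<le> \<delta> e\<^sup>L\<close>, and \<open>e\<^sup>-\<^sup>d\<^sup>L\<close> decreases, so a left-endpoint sum
  dominates the integral. The rounding in the ranks also goes in the right direction, and
  \<open>\<delta>\<^sup>d |A\<^sub>i| \<ge> F(L\<^sub>i\<^sub>+\<^sub>1) - F(L\<^sub>i)\<close> holds without error term. This gives \<open>\<delta>\<^sup>d B \<ge> F(T)\<close> for the
  bracketing count (lemma \<open>B_bracket_sh_ge\<close>).

  Upper bound. It suffices to treat the covering count, which is the larger one. The union of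
  a layer and its translate only lengthens the range of sums by \<open>d\<close>, that is, replaces
  \<open>L\<^sub>i\<^sub>+\<^sub>1\<close> by \<open>L\<^sub>i\<^sub>+\<^sub>1 + c\<^sub>i\<close>; the error of the approximation \<open>r\<^sup>d / d!\<close> costs another \<open>c\<^sub>i\<close> there, and
  the lower rank starts one \<open>c\<^sub>i\<close> below \<open>L\<^sub>i\<close>. Because
  \<open>L\<^sub>i\<^sub>+\<^sub>1 - L\<^sub>i = c\<^sub>i / w\<close> with \<open>w = \<surd>(d \<delta>)\<close>, these losses are a factor \<open>1 + 3 w\<close>. Split the
  steps at the level \<open>K = log (1/\<delta>) / 4\<close>, where \<open>\<delta> e\<^sup>L\<close> equals \<open>q = \<delta>\<^sup>3\<^sup>/\<^sup>4\<close>. Below \<open>K\<close> the step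
  lengths are at most \<open>q / w\<close>, which tends to 0, so the layer is at most \<open>1 + o(1)\<close> times an
  increment of a translate of \<open>F\<close> (lemma \<open>cov_bound_fine\<close>). Above \<open>K\<close> the steps may be
  long, but \<open>c\<^sub>i \<ge> q / 2\<close>: a layer contributes at most a constant times
  \<open>(\<delta> T / q)\<^sup>d\<close>, of order \<open>\<delta>\<^sup>d\<^sup>/\<^sup>4\<close> up to logarithms (lemma \<open>cov_bound_coarse\<close>), and there
  are at most \<open>2 w T / q + 1\<close> such layers, of order \<open>\<delta>\<^sup>-\<^sup>1\<^sup>/\<^sup>4\<close> up to logarithms. For \<open>d \<ge> 2\<close>
  the product vanishes in the limit; this is where that hypothesis enters.\<close>

section \<open>Lattice points in a discrete simplex\<close>

definition lists_below :: "nat \<Rightarrow> nat \<Rightarrow> nat list set" where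
  "lists_below d k = {n. length n = d \<and> sum_list n < k}"

lemma finite_lists_below: "finite (lists_below d k)"
proof (rule finite_subset)
  show "lists_below d k \<subseteq> {n. set n \<subseteq> {..k} \<and> length n = d}"
    using member_le_sum_list by (fastforce simp: lists_below_def)
qed (simp add: finite_lists_length_eq)

lemma lists_below_mono: "k \<le> m \<Longrightarrow> lists_below d k \<subseteq> lists_below d m"
  by (auto simp: lists_below_def)

lemma card_lists_below: "d \<ge> 1 \<Longrightarrow> card (lists_below d k) = (k + d - 1) choose d"
proof (cases k)
  case 0
  assume "d \<ge> 1"
  then show ?thesis using 0 by (simp add: lists_below_def)
next
  case (Suc r)
  let ?S = "{l::nat list. length l = Suc d \<and> sum_list l = r}"
  \<comment> \<open>A slack coordinate turns the bound on the sum into an equality.\<close>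
  have "bij_betw (\<lambda>n. (r - sum_list n) # n) (lists_below d k) ?S"
    by (rule bij_betw_byWitness[where f' = tl])
       (auto simp: lists_below_def Suc length_Suc_conv)
  then have "card (lists_below d k) = card ?S"
    by (rule bij_betw_same_card)
  also have "\<dots> = (r + Suc d - 1) choose r"
    by (rule card_length_sum_list)
  also have "\<dots> = (r + d) choose d"
    using binomial_symmetric[of r "r + d"] by simp
  finally show ?thesis using Suc by simp
qed

text \<open>The count is the rising factorial of \<open>k\<close> of length \<open>d\<close>, divided by \<open>d!\<close>; its factors lie
  between \<open>k\<close> and \<open>k + d - 1\<close>.\<close>

lemma card_lists_below_bounds:
  assumes "d \<ge> 1"
  shows "real k ^ d / fact d \<le> real (card (lists_below d k))"
    and "real (card (lists_below d k)) \<le> (real k + real d - 1) ^ d / fact d"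
proof -
  have "real (card (lists_below d k)) = pochhammer (real k) d / fact d"
    using assms by (simp add: card_lists_below binomial_gbinomial gbinomial_pochhammer' of_nat_diff)
  also have "pochhammer (real k) d = (\<Prod>j<d. real k + real j)"
    by (simp add: pochhammer_prod atLeast0LessThan)
  finally have eq: "real (card (lists_below d k)) = (\<Prod>j<d. real k + real j) / fact d" .
  have "(\<Prod>j<d. real k) \<le> (\<Prod>j<d. real k + real j)"
    by (rule prod_mono) simp
  then show "real k ^ d / fact d \<le> real (card (lists_below d k))"
    unfolding eq by (simp add: divide_right_mono)
  have "(\<Prod>j<d. real k + real j) \<le> (\<Prod>j<d. real k + real d - 1)"
  proof (rule prod_mono)
    fix j assume "j \<in> {..<d}"
    then have "real j + 1 \<le> real d" by (simp add: nat_less_real_le)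
    then show "0 \<le> real k + real j \<and> real k + real j \<le> real k + real d - 1" by simp
  qed
  then show "real (card (lists_below d k)) \<le> (real k + real d - 1) ^ d / fact d"
    unfolding eq by (simp add: divide_right_mono)
qed

section \<open>The Erlang distribution function\<close>

text \<open>The distribution function of the Erlang law with shape and rate both equal to \<open>d\<close>, that is,
  one minus the probability that a Poisson variable with mean \<open>d x\<close> is below \<open>d\<close>.\<close>

definition erlang :: "nat \<Rightarrow> real \<Rightarrow> real" where
  "erlang d x = 1 - exp (- (real d * x)) * (\<Sum>k<d. (real d * x) ^ k / fact k)"

text \<open>The derivative of each summand cancels part of that of the next one, and only the top term
  survives.\<close>

lemma DERIV_exp_partial_sum:
  fixes a :: real
  shows "((\<lambda>x. exp (- (a * x)) * (\<Sum>k<Suc n. (a * x) ^ k / fact k)) has_real_derivative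
     - (a * (a * x) ^ n / fact n * exp (- (a * x)))) (at x)"
proof (induction n)
  case 0
  show ?case by (auto intro!: derivative_eq_intros)
next
  case (Suc n)
  have "((\<lambda>x. (a * x) ^ Suc n) has_real_derivative (1 + real n) * (a * (a * x) ^ n)) (at x)"
    by (intro DERIV_power_Suc) (auto intro!: derivative_eq_intros)
  from DERIV_cdivide[OF this, of "fact (Suc n)"]
  have power_part: "((\<lambda>x. (a * x) ^ Suc n / fact (Suc n)) has_real_derivative a * (a * x) ^ n / fact n) (at x)"
  proof (rule DERIV_cong)
    have nonzero: "1 + real n \<noteq> 0" by linarith
    have "(fact (Suc n) :: real) = (1 + real n) * fact n" by simp
    then show "(1 + real n) * (a * (a * x) ^ n) / fact (Suc n) = a * (a * x) ^ n / fact n"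
      by (simp only: mult_divide_mult_cancel_left[OF nonzero])
  qed
  have exp_part: "((\<lambda>x. exp (- (a * x))) has_real_derivative - a * exp (- (a * x))) (at x)"
    by (auto intro!: derivative_eq_intros)
  have "- (a * (a * x) ^ n / fact n * exp (- (a * x)))
      + (- a * exp (- (a * x)) * ((a * x) ^ Suc n / fact (Suc n))
         + a * (a * x) ^ n / fact n * exp (- (a * x)))
    = - (a * (a * x) ^ Suc n / fact (Suc n) * exp (- (a * x)))"
    by (simp del: fact_Suc power_Suc)
  from DERIV_cong[OF DERIV_add[OF Suc DERIV_mult[OF exp_part power_part]] this]
  show ?case
    unfolding sum.lessThan_Suc[of _ "Suc n"] distrib_left .
qed

text \<open>The density is written with the constant \<open>d\<^sup>d / d!\<close> in front because this is the factor
  that the lattice point count produces.\<close>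

lemma DERIV_erlang:
  assumes "d \<ge> 1"
  shows "(erlang d has_real_derivative
     real d ^ d / fact d * (real d * x ^ (d - 1)) * exp (- (real d * x))) (at x)"
proof -
  obtain n where n: "d = Suc n" using assms by (cases d) auto
  have "(erlang d has_real_derivative
     real d * (real d * x) ^ n / fact n * exp (- (real d * x))) (at x)"
    using DERIV_diff[OF DERIV_const DERIV_exp_partial_sum[of "real d" n x], of 1]
    unfolding erlang_def n by simp
  moreover have "real d ^ d / fact d * (real d * x ^ (d - 1)) = real d * (real d * x) ^ n / fact n"
  proof -
    have "fact d = real d * fact n" by (simp add: n)
    then show ?thesis using assms by (simp add: n power_mult_distrib del: of_nat_Suc fact_Suc)
  qed
  ultimately show ?thesis by simp
qed

lemma erlang_0: "d \<ge> 1 \<Longrightarrow> erlang d 0 = 0"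
  by (cases d) (simp_all add: erlang_def sum.lessThan_Suc_shift del: sum.lessThan_Suc)

lemma erlang_le_1: "x \<ge> 0 \<Longrightarrow> erlang d x \<le> 1"
  by (simp add: erlang_def sum_nonneg)

lemma erlang_mono:
  assumes "d \<ge> 1" "0 \<le> x" "x \<le> y"
  shows "erlang d x \<le> erlang d y"
proof (rule DERIV_nonneg_imp_nondecreasing[OF assms(3)])
  fix z assume "x \<le> z" "z \<le> y"
  then show "\<exists>D. (erlang d has_real_derivative D) (at z) \<and> 0 \<le> D"
    using DERIV_erlang[OF assms(1), of z] assms
    by (intro exI[of _ "real d ^ d / fact d * (real d * z ^ (d - 1)) * exp (- (real d * z))"]) simp
qed

lemma erlang_tendsto: "(erlang d \<longlongrightarrow> 1) at_top"
proof (cases "d = 0")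
  case False
  have lim: "filterlim (\<lambda>x. real d * x) at_top at_top"
    using False by (intro filterlim_tendsto_pos_mult_at_top[OF tendsto_const]) (auto intro: filterlim_ident)
  have "((\<lambda>x. 1 - (\<Sum>k<d. ((real d * x) ^ k / exp (real d * x)) / fact k)) \<longlongrightarrow> 1 - (\<Sum>k<d. 0 / fact k)) at_top"
    by (intro tendsto_intros filterlim_compose[OF tendsto_power_div_exp_0 lim]) auto
  moreover have "erlang d = (\<lambda>x. 1 - (\<Sum>k<d. ((real d * x) ^ k / exp (real d * x)) / fact k))"
    by (rule ext) (simp add: erlang_def exp_minus sum_distrib_left field_simps)
  ultimately show ?thesis by simp
qed (simp add: erlang_def[abs_def])

text \<open>The left-endpoint value of the exponential bounds it from above on the interval; the
  factor \<open>d z\<^sup>d\<^sup>-\<^sup>1\<close> of the density is kept and integrates to a difference of powers.\<close>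

lemma erlang_increment_le:
  assumes "d \<ge> 1" "0 \<le> x" "x \<le> y"
  shows "erlang d y - erlang d x \<le> real d ^ d / fact d * exp (- (real d * x)) * (y ^ d - x ^ d)"
proof -
  let ?C = "real d ^ d / fact d"
  have "?C * exp (- (real d * x)) * x ^ d - erlang d x \<le> ?C * exp (- (real d * x)) * y ^ d - erlang d y"
  proof (rule DERIV_nonneg_imp_nondecreasing[OF assms(3)])
    fix z assume z: "x \<le> z" "z \<le> y"
    have "((\<lambda>z. ?C * exp (- (real d * x)) * z ^ d - erlang d z) has_real_derivative
       ?C * exp (- (real d * x)) * (real d * z ^ (d - 1)) - ?C * (real d * z ^ (d - 1)) * exp (- (real d * z))) (at z)"
      by (intro DERIV_diff DERIV_erlang[OF assms(1)] DERIV_cmult) (auto intro!: derivative_eq_intros)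
    moreover have "?C * (real d * z ^ (d - 1)) * exp (- (real d * z)) \<le> ?C * (real d * z ^ (d - 1)) * exp (- (real d * x))"
      using z assms by (intro mult_left_mono) auto
    ultimately show "\<exists>D. ((\<lambda>z. ?C * exp (- (real d * x)) * z ^ d - erlang d z) has_real_derivative D) (at z) \<and> 0 \<le> D"
      by (intro exI conjI) (auto simp: algebra_simps)
  qed
  then show ?thesis by (simp only: right_diff_distrib)
qed

text \<open>Here both factors of the density are replaced by their infima over the interval, one at each
  endpoint.\<close>

lemma erlang_increment_ge:
  assumes "d \<ge> 1" "0 \<le> x" "x \<le> y"
  shows "real d ^ d / fact d * (real d * x ^ (d - 1)) * exp (- (real d * y)) * (y - x)
    \<le> erlang d y - erlang d x"
proof (cases "x = y")
  case False
  then obtain z where z: "x < z" "z < y"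
    and eq: "erlang d y - erlang d x
      = (y - x) * (real d ^ d / fact d * (real d * z ^ (d - 1)) * exp (- (real d * z)))"
    using MVT2[of x y "erlang d", OF _ DERIV_erlang[OF assms(1)]] assms by (auto simp: less_le)
  have "real d ^ d / fact d * (real d * x ^ (d - 1)) * exp (- (real d * y))
      \<le> real d ^ d / fact d * (real d * z ^ (d - 1)) * exp (- (real d * z))"
    using z assms by (intro mult_mono power_mono mult_nonneg_nonneg) auto
  then have "(real d ^ d / fact d * (real d * x ^ (d - 1)) * exp (- (real d * y))) * (y - x)
      \<le> (real d ^ d / fact d * (real d * z ^ (d - 1)) * exp (- (real d * z))) * (y - x)"
    using assms by (intro mult_right_mono) auto
  then show ?thesis unfolding eq by (simp only: mult.commute)
qed simp

section \<open>The levels and their layers\<close>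

text \<open>Unfolding the minimum in the recursion turns every occurrence of a next level into a case
  distinction.\<close>

declare sh_L.simps(2) [simp del]

abbreviation sh_T :: "nat \<Rightarrow> real \<Rightarrow> real" where
  "sh_T d \<delta> \<equiv> real d * ln (inverse \<delta>)"

context
  fixes d :: nat and \<delta> :: real
  assumes d: "d \<ge> 1" and \<delta>: "0 < \<delta>" "\<delta> < 1"
begin

lemma sh_T_pos: "0 < sh_T d \<delta>"
  using d \<delta> by (simp add: one_less_inverse)

lemma sh_L_nonneg: "0 \<le> sh_L d \<delta> i"
  using \<delta> sh_T_pos by (induction i) (auto simp: sh_L.simps(2) intro!: add_nonneg_nonneg ln_ge_zero)

lemma sh_L_le: "sh_L d \<delta> i \<le> sh_T d \<delta>"
  using sh_T_pos by (cases i) (auto simp: sh_L.simps(2))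

lemma sh_c_pos: "0 < sh_c d \<delta> i"
  using \<delta> unfolding sh_c_def by (intro ln_gt_zero) simp

lemma sh_c_le: "sh_c d \<delta> i \<le> \<delta> * exp (sh_L d \<delta> i)"
  using \<delta> unfolding sh_c_def by (intro ln_add_one_self_le_self) simp

lemma sh_L_mono: "sh_L d \<delta> i \<le> sh_L d \<delta> (Suc i)"
  using sh_c_pos[of i] sh_L_le[of i] \<delta> by (simp add: sh_L_Suc)

lemma sh_L_Suc_pos: "0 < sh_L d \<delta> (Suc i)"
  using sh_c_pos[of i] sh_L_nonneg[of i] sh_T_pos \<delta> d
  by (auto simp: sh_L_Suc intro!: add_nonneg_pos)

lemma sh_L_J: "sh_L d \<delta> (sh_J d \<delta>) = sh_T d \<delta>"
  unfolding sh_J_def using LeastI_ex[OF sh_J_exists[OF d \<delta>]] .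

text \<open>Only the last step can be cut off at the top level, since \<open>J\<close> is the first index that
  reaches it.\<close>

lemma sh_L_Suc_untruncated:
  assumes "Suc i < sh_J d \<delta>"
  shows "sh_L d \<delta> (Suc i) = sh_L d \<delta> i + sh_c d \<delta> i / sqrt (real d * \<delta>)"
  using not_less_Least[OF assms[unfolded sh_J_def]]
  unfolding sh_L_Suc by (simp add: min_def split: if_splits)

lemma sum_increments_J:
  fixes f :: "real \<Rightarrow> real"
  shows "(\<Sum>i<sh_J d \<delta>. f (sh_L d \<delta> (Suc i)) - f (sh_L d \<delta> i)) = f (sh_T d \<delta>) - f 0"
  using sum_lessThan_telescope[of "\<lambda>i. f (sh_L d \<delta> i)" "sh_J d \<delta>"] sh_L_J by simp

lemma int_sh_r_minus: "int (nat (sh_r_minus d \<delta> i)) = sh_r_minus d \<delta> i"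
  by (simp add: sh_r_minus_def)

lemma sh_r_plus_nonneg: "0 \<le> sh_r_plus d \<delta> i"
proof -
  have "0 < real d * sh_L d \<delta> (Suc i) / sh_c d \<delta> i"
    using d sh_c_pos sh_L_Suc_pos by simp
  then show ?thesis by (simp add: sh_r_plus_def)
qed

lemma sh_A_eq: "sh_A d \<delta> i = lists_below d (Suc (nat (sh_r_plus d \<delta> i))) - lists_below d (nat (sh_r_minus d \<delta> i))"
  using sh_r_plus_nonneg[of i] int_sh_r_minus[of i] by (auto simp: sh_A_def lists_below_def)

text \<open>Adding the all-ones vector raises the coordinate sum by \<open>d\<close>, so a layer and its translate lie
  in one thicker layer.\<close>

lemma sh_A_cov_subset:
  "sh_A d \<delta> i \<union> map Suc ` sh_A d \<delta> i
     \<subseteq> lists_below d (nat (sh_r_plus d \<delta> i) + d + 1) - lists_below d (nat (sh_r_minus d \<delta> i))"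
proof -
  have "sum_list (map Suc n) = sum_list n + length n" for n
    by (induction n) auto
  then show ?thesis
    using sh_r_plus_nonneg[of i] int_sh_r_minus[of i] by (auto simp: sh_A_def lists_below_def)
qed

text \<open>Both roundings help: the upper rank plus one is at least \<open>d L\<^sub>i\<^sub>+\<^sub>1 / c\<^sub>i\<close>, and the shift by
  \<open>- 1\<close> inside the lower rank offsets the \<open>d - 1\<close> in the upper bound for the simplex
  below it.\<close>

lemma card_sh_A_ge:
  "real d ^ d / fact d * (sh_L d \<delta> (Suc i) ^ d - sh_L d \<delta> i ^ d) / sh_c d \<delta> i ^ d
    \<le> real (card (sh_A d \<delta> i))"
proof -
  let ?L = "sh_L d \<delta> i" and ?M = "sh_L d \<delta> (Suc i)" and ?c = "sh_c d \<delta> i"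
  let ?p = "Suc (nat (sh_r_plus d \<delta> i))" and ?m = "nat (sh_r_minus d \<delta> i)"
  have c: "0 < ?c" by (rule sh_c_pos)
  have p: "real d * ?M / ?c \<le> real ?p"
    using sh_r_plus_nonneg[of i] by (simp add: sh_r_plus_def)
  have "(real d * ?M / ?c) ^ d / fact d \<le> real (card (lists_below d ?p))"
  proof -
    have "0 \<le> real d * ?M / ?c"
      using sh_L_Suc_pos[of i] c by simp
    with p have "(real d * ?M / ?c) ^ d / fact d \<le> real ?p ^ d / fact d"
      by (intro divide_right_mono power_mono) simp_all
    then show ?thesis using card_lists_below_bounds(1)[OF d, of ?p] by linarith
  qed
  moreover have "real (card (lists_below d ?m)) \<le> (real d * ?L / ?c) ^ d / fact d"
  \<comment> \<open>If the lower rank is cut off at 0, nothing lies below the layer.\<close>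
  proof (cases "?m = 0")
    case True
    then show ?thesis
      using c sh_L_nonneg[of i] by (simp add: lists_below_def)
  next
    case False
    then have "real ?m = of_int \<lceil>real d * (?L / ?c - 1)\<rceil>"
      by (simp add: sh_r_minus_def max_def split: if_splits)
    then have "real ?m + real d - 1 \<le> real d * ?L / ?c"
      using ceiling_correct[of "real d * (?L / ?c - 1)"] by (simp add: right_diff_distrib)
    then show ?thesis
      using d False
      by (intro order_trans[OF card_lists_below_bounds(2)[OF d]] divide_right_mono power_mono) auto
  qed
  moreover have "real (card (lists_below d ?p)) - real (card (lists_below d ?m)) \<le> real (card (sh_A d \<delta> i))"
    unfolding sh_A_eq using diff_card_le_card_Diff[OF finite_lists_below[of d ?m], of "lists_below d ?p"] by linarith
  moreover have "real d ^ d / fact d * (?M ^ d - ?L ^ d) / ?c ^ d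
     = (real d * ?M / ?c) ^ d / fact d - (real d * ?L / ?c) ^ d / fact d"
    by (simp add: power_mult_distrib power_divide right_diff_distrib diff_divide_distrib mult.commute)
  ultimately show ?thesis by linarith
qed

text \<open>One \<open>c\<^sub>i\<close> at the upper end is the thickening by the translate, the other one the gap between
  the two bounds for a simplex; the \<open>c\<^sub>i\<close> at the lower end is the shift in the lower rank. The
  maximum with 0 keeps the subtracted power from being that of a negative number.\<close>

lemma card_sh_A_cov_le:
  "real (card (sh_A d \<delta> i \<union> map Suc ` sh_A d \<delta> i))
    \<le> real d ^ d / fact d * ((sh_L d \<delta> (Suc i) + 2 * sh_c d \<delta> i) ^ d
         - max 0 (sh_L d \<delta> i - sh_c d \<delta> i) ^ d) / sh_c d \<delta> i ^ d"
proof -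
  let ?L = "sh_L d \<delta> i" and ?M = "sh_L d \<delta> (Suc i)" and ?c = "sh_c d \<delta> i"
  let ?p = "nat (sh_r_plus d \<delta> i) + d + 1" and ?m = "nat (sh_r_minus d \<delta> i)"
  have c: "0 < ?c" by (rule sh_c_pos)
  have "real (nat (sh_r_plus d \<delta> i)) \<le> real d * ?M / ?c"
    using sh_r_plus_nonneg[of i] ceiling_correct[of "real d * ?M / ?c"]
    by (simp add: sh_r_plus_def)
  then have "real ?p + real d - 1 \<le> real d * (?M + 2 * ?c) / ?c"
    using c by (simp add: field_simps)
  then have up: "real (card (lists_below d ?p)) \<le> (real d * (?M + 2 * ?c) / ?c) ^ d / fact d"
    by (intro order_trans[OF card_lists_below_bounds(2)[OF d]] divide_right_mono power_mono) auto
  have "real d * max 0 (?L - ?c) / ?c \<le> real ?m"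
  proof -
    have "real d * max 0 (?L - ?c) / ?c = max 0 (real d * (?L / ?c - 1))"
      using c d by (auto simp: max_def field_simps)
    then show ?thesis
      by (simp add: sh_r_minus_def) linarith
  qed
  then have lo: "(real d * max 0 (?L - ?c) / ?c) ^ d / fact d \<le> real (card (lists_below d ?m))"
    using c
    by (intro order_trans[OF divide_right_mono[OF power_mono] card_lists_below_bounds(1)[OF d]]) auto
  have sub: "lists_below d ?m \<subseteq> lists_below d ?p" if "?m \<le> ?p"
    using that by (rule lists_below_mono)
  have "?m \<le> ?p"
  proof -
    have "?L / ?c - 1 \<le> ?M / ?c"
      using divide_right_mono[OF sh_L_mono[of i], of ?c] c by simp
    then have "real d * (?L / ?c - 1) \<le> real d * ?M / ?c"
      using mult_left_mono[of "?L / ?c - 1" "?M / ?c" "real d"] by simp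
    then have "\<lceil>real d * (?L / ?c - 1)\<rceil> \<le> \<lceil>real d * ?M / ?c\<rceil>"
      by (rule ceiling_mono)
    then show ?thesis using sh_r_plus_nonneg[of i] d
      by (simp add: sh_r_minus_def sh_r_plus_def)
  qed
  have "card (sh_A d \<delta> i \<union> map Suc ` sh_A d \<delta> i) \<le> card (lists_below d ?p - lists_below d ?m)"
    by (intro card_mono sh_A_cov_subset finite_Diff finite_lists_below)
  also have "\<dots> = card (lists_below d ?p) - card (lists_below d ?m)"
    by (intro card_Diff_subset finite_lists_below sub[OF \<open>?m \<le> ?p\<close>])
  finally have "real (card (sh_A d \<delta> i \<union> map Suc ` sh_A d \<delta> i))
      \<le> real (card (lists_below d ?p)) - real (card (lists_below d ?m))"
    using card_mono[OF finite_lists_below sub[OF \<open>?m \<le> ?p\<close>]] by linarith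
  moreover have "real d ^ d / fact d * ((?M + 2 * ?c) ^ d - max 0 (?L - ?c) ^ d) / ?c ^ d
     = (real d * (?M + 2 * ?c) / ?c) ^ d / fact d - (real d * max 0 (?L - ?c) / ?c) ^ d / fact d"
    by (simp add: power_mult_distrib power_divide right_diff_distrib diff_divide_distrib mult.commute)
  ultimately show ?thesis using up lo by linarith
qed

text \<open>Each layer is at least an increment of \<open>erlang d\<close>, because \<open>\<delta> / c\<^sub>i \<ge> exp (- L\<^sub>i)\<close> and the
  left-endpoint sum dominates.\<close>

lemma B_bracket_sh_ge: "erlang d (sh_T d \<delta>) \<le> \<delta> ^ d * real (B_bracket_sh d \<delta>)"
proof -
  have step: "erlang d (sh_L d \<delta> (Suc i)) - erlang d (sh_L d \<delta> i) \<le> \<delta> ^ d * real (card (sh_A d \<delta> i))" for i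
  proof -
    let ?L = "sh_L d \<delta> i" and ?M = "sh_L d \<delta> (Suc i)" and ?c = "sh_c d \<delta> i"
    let ?C = "real d ^ d / fact d"
    have pos: "0 \<le> ?C * (?M ^ d - ?L ^ d)"
      using sh_L_mono[of i] sh_L_nonneg[of i] by (simp add: power_mono)
    have "exp (- ?L) \<le> \<delta> / ?c"
      using sh_c_le[of i] sh_c_pos[of i] by (simp add: exp_minus field_simps)
    then have "exp (- ?L) ^ d \<le> (\<delta> / ?c) ^ d"
      by (intro power_mono) auto
    then have "exp (- (real d * ?L)) \<le> \<delta> ^ d / ?c ^ d"
      by (simp add: exp_of_nat_mult[symmetric] power_divide)
    from mult_left_mono[OF this pos]
    have "?C * exp (- (real d * ?L)) * (?M ^ d - ?L ^ d) \<le> \<delta> ^ d * (?C * (?M ^ d - ?L ^ d) / ?c ^ d)"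
      by (simp add: mult_ac)
    also have "\<dots> \<le> \<delta> ^ d * real (card (sh_A d \<delta> i))"
      using \<delta> by (intro mult_left_mono card_sh_A_ge) auto
    finally show ?thesis
      using erlang_increment_le[OF d sh_L_nonneg sh_L_mono, of i] by linarith
  qed
  have "erlang d (sh_T d \<delta>) = (\<Sum>i<sh_J d \<delta>. erlang d (sh_L d \<delta> (Suc i)) - erlang d (sh_L d \<delta> i))"
    using sum_increments_J[of "erlang d"] erlang_0[OF d] by simp
  also have "\<dots> \<le> (\<Sum>i<sh_J d \<delta>. \<delta> ^ d * real (card (sh_A d \<delta> i)))"
    by (intro sum_mono step)
  also have "\<dots> \<le> \<delta> ^ d * real (B_bracket_sh d \<delta>)"
    using \<delta> by (simp add: B_bracket_sh_def sum_distrib_left[symmetric] mult_left_mono)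
  finally show ?thesis .
qed

end

lemma B_bracket_sh_le_B_cov_sh: "B_bracket_sh d \<delta> \<le> B_cov_sh d \<delta>"
  unfolding B_bracket_sh_def B_cov_sh_def
  by (intro add_left_mono sum_mono card_mono) (auto simp: finite_sh_A)

section \<open>Upper bound for the covering count\<close>

lemma power_diff_le:
  fixes a b :: real
  assumes "0 \<le> b" "b \<le> a"
  shows "a ^ n - b ^ n \<le> real n * (a - b) * a ^ (n - 1)"
proof -
  have "b ^ (n - Suc i) * a ^ i \<le> a ^ (n - 1)" if "i < n" for i
  proof -
    have "b ^ (n - Suc i) * a ^ i \<le> a ^ (n - Suc i) * a ^ i"
      using assms by (intro mult_right_mono power_mono) auto
    then show ?thesis using that by (simp add: power_add[symmetric])
  qed
  then have "(\<Sum>i<n. b ^ (n - Suc i) * a ^ i) \<le> (\<Sum>i<n. a ^ (n - 1))"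
    by (intro sum_mono) simp
  then have "(a - b) * (\<Sum>i<n. b ^ (n - Suc i) * a ^ i) \<le> (a - b) * (real n * a ^ (n - 1))"
    using assms by (intro mult_left_mono) auto
  then show ?thesis by (simp add: power_diff_sumr2 mult_ac)
qed

lemma ln_one_plus_ge:
  fixes x :: real
  assumes "0 \<le> x"
  shows "x / (1 + x) \<le> ln (1 + x)"
proof -
  have "ln (1 / (1 + x)) \<le> 1 / (1 + x) - 1"
    using assms by (intro ln_le_minus_one) simp
  then show ?thesis using assms by (simp add: ln_div field_simps)
qed

context
  fixes d :: nat and \<delta> :: real
  assumes d: "d \<ge> 1" and \<delta>: "0 < \<delta>" "\<delta> < 1"
begin

text \<open>Since \<open>exp T = \<delta>\<^sup>-\<^sup>d\<close> is at least 2, the argument \<open>1 + \<delta> exp T\<close> of the logarithm stays below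
  \<open>exp T\<close>.\<close>

lemma sh_c_le_T:
  assumes "\<delta> \<le> 1 / 2"
  shows "sh_c d \<delta> i \<le> sh_T d \<delta>"
proof -
  define E where "E = inverse \<delta> ^ d"
  have "inverse \<delta> \<ge> 2" using assms \<delta> by (simp add: field_simps)
  then have E: "2 \<le> E"
    using power_increasing[of 1 d "inverse \<delta>"] d by (simp add: E_def)
  have T: "exp (sh_T d \<delta>) = E"
    using \<delta> by (simp add: E_def exp_of_nat_mult)
  have "1 + \<delta> * exp (sh_L d \<delta> i) \<le> 1 + \<delta> * E"
    using sh_L_le[OF d \<delta>, of i] \<delta> by (simp add: T[symmetric])
  also have "\<dots> \<le> E"
    using E assms mult_right_mono[of \<delta> "1/2" E] by linarith
  finally have "ln (1 + \<delta> * exp (sh_L d \<delta> i)) \<le> ln E"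
    using \<delta> by (intro ln_mono add_pos_pos) auto
  then show ?thesis by (simp only: sh_c_def ln_exp flip: T)
qed

text \<open>The level \<open>K\<close> separates fine from coarse steps. Here \<open>q\<close> is the value of \<open>\<delta> e\<^sup>L\<close> at \<open>K\<close>, an
  upper bound for \<open>c\<^sub>i\<close> below \<open>K\<close>, and \<open>q / w\<close> bounds the step length there. The last
  assumption says that a step starting below \<open>K\<close> is never cut off at the top level.\<close>

context
  fixes q K w :: real
  assumes w: "w = sqrt (real d * \<delta>)" and q: "q = \<delta> * exp K" and q1: "q \<le> 1"
    and K: "K + q / w \<le> sh_T d \<delta>"
begin

abbreviation "cov_bound i \<equiv> real d ^ d / fact d * ((sh_L d \<delta> (Suc i) + 2 * sh_c d \<delta> i) ^ d
         - max 0 (sh_L d \<delta> i - sh_c d \<delta> i) ^ d) / sh_c d \<delta> i ^ d"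

lemma w_pos: "0 < w" using w d \<delta> by simp
lemma q_pos: "0 < q" using q \<delta> by simp

text \<open>The layer is at most its width times \<open>d\<close> times a power of its upper end. Translating
  \<open>erlang d\<close> by \<open>s = q / w + 2 q\<close> absorbs the overshoot \<open>L\<^sub>i\<^sub>+\<^sub>1 + 2 c\<^sub>i \<le> L\<^sub>i + s\<close> in the power:
  the power of the translated density is then large enough already at the left endpoint. The price
  is in the exponential, whose argument moves by at most \<open>q / w + s = 2 (q / w + q)\<close>; the other
  factors are \<open>\<delta> / c\<^sub>i \<le> (1 + q) exp (- L\<^sub>i)\<close> and the excess \<open>3 c\<^sub>i = 3 w (L\<^sub>i\<^sub>+\<^sub>1 - L\<^sub>i)\<close> of
  the layer width.\<close>

lemma cov_bound_fine:
  assumes LK: "sh_L d \<delta> i \<le> K"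
  shows "\<delta> ^ d * cov_bound i
    \<le> (1 + q) ^ d * (1 + 3 * w) * exp (2 * real d * (q / w + q))
      * (erlang d (sh_L d \<delta> (Suc i) + (q / w + 2 * q)) - erlang d (sh_L d \<delta> i + (q / w + 2 * q)))"
proof -
  define L M c s where "L = sh_L d \<delta> i" and "M = sh_L d \<delta> (Suc i)" and "c = sh_c d \<delta> i"
    and "s = q / w + 2 * q"
  let ?C = "real d ^ d / fact d"
  note w_pos q_pos
  have L: "0 \<le> L" unfolding L_def by (rule sh_L_nonneg[OF d \<delta>])
  have c: "0 < c" unfolding c_def by (rule sh_c_pos[OF d \<delta>])
  define x where "x = \<delta> * exp L"
  have x: "0 < x" "x \<le> q"
    using \<delta> LK by (simp_all add: x_def q L_def)
  have "c \<le> x" unfolding c_def x_def L_def by (rule sh_c_le[OF d \<delta>])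
  then have cq: "c \<le> q" using x by simp
  have "x / (1 + q) \<le> x / (1 + x)"
    using x by (intro divide_left_mono) auto
  also have "\<dots> \<le> c"
    using ln_one_plus_ge[of x] x unfolding c_def sh_c_def x_def L_def by simp
  finally have "\<delta> / c \<le> (1 + q) * exp (- L)"
    using c \<open>0 < q\<close> by (simp add: x_def exp_minus field_simps)
  then have "(\<delta> / c) ^ d \<le> ((1 + q) * exp (- L)) ^ d"
    using \<delta> c by (intro power_mono) auto
  then have dc: "\<delta> ^ d / c ^ d \<le> (1 + q) ^ d * exp (- (real d * L))"
    by (simp add: power_mult_distrib power_divide exp_of_nat_mult[symmetric])
  have "c / w \<le> q / w" using cq \<open>0 < w\<close> by (simp add: divide_right_mono)
  then have M: "M = L + c / w"
    using K LK unfolding M_def L_def c_def sh_L_Suc w[symmetric] by linarith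
  define a b where "a = M + 2 * c" and "b = max 0 (L - c)"
  have cw: "0 < c / w" using c \<open>0 < w\<close> by simp
  have ab: "0 \<le> b" "b \<le> a" "a - b \<le> c / w * (1 + 3 * w)" "a \<le> L + s"
    using M c cw L \<open>0 < w\<close> \<open>c / w \<le> q / w\<close> cq
    by (auto simp: a_def b_def s_def distrib_left)
  have "a ^ d - b ^ d \<le> real d * (a - b) * a ^ (d - 1)"
    by (rule power_diff_le) (use ab in auto)
  also have "\<dots> \<le> real d * (c / w * (1 + 3 * w)) * (L + s) ^ (d - 1)"
    using ab cw \<open>0 < w\<close> by (intro mult_mono power_mono mult_nonneg_nonneg) auto
  finally have "?C * (a ^ d - b ^ d) \<le> ?C * (real d * (c / w * (1 + 3 * w)) * (L + s) ^ (d - 1))"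
    by (intro mult_left_mono) auto
  then have "(?C * (a ^ d - b ^ d)) * (\<delta> ^ d / c ^ d)
      \<le> (?C * (real d * (c / w * (1 + 3 * w)) * (L + s) ^ (d - 1))) * ((1 + q) ^ d * exp (- (real d * L)))"
    using ab c cw \<delta> \<open>0 < w\<close> \<open>0 < q\<close>
    by (intro mult_mono[OF _ dc] mult_nonneg_nonneg zero_le_power) auto
  also have "\<dots> = (1 + q) ^ d * (1 + 3 * w) * exp (2 * real d * (q / w + q))
     * (?C * (real d * (L + s) ^ (d - 1)) * (exp (- (real d * L)) * exp (- (2 * real d * (q / w + q)))) * (c / w))"
  proof -
    \<comment> \<open>Insert the exponential and its inverse, to split off the shift of the density.\<close>
    have rearrange: "C * (D * (h * r) * P) * (Q * e) = Q * r * E * (C * (D * P) * (e * E') * h)"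
      if "E * E' = 1" for C D h r P Q e E E' :: real
    proof -
      have "Q * r * E * (C * (D * P) * (e * E') * h) = C * (D * (h * r) * P) * (Q * e) * (E * E')"
        by (simp only: mult_ac)
      then show ?thesis using that by simp
    qed
    show ?thesis by (rule rearrange) (simp add: exp_minus)
  qed
  also have "\<dots> \<le> (1 + q) ^ d * (1 + 3 * w) * exp (2 * real d * (q / w + q))
     * (erlang d (M + s) - erlang d (L + s))"
  proof (rule mult_left_mono)
    have "exp (- (real d * L)) * exp (- (2 * real d * (q / w + q))) \<le> exp (- (real d * (M + s)))"
      using mult_left_mono[OF \<open>c / w \<le> q / w\<close>, of "real d"]
      by (simp add: exp_add[symmetric] M s_def algebra_simps)
    then have "?C * (real d * (L + s) ^ (d - 1)) * (exp (- (real d * L)) * exp (- (2 * real d * (q / w + q)))) * (c / w)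
        \<le> ?C * (real d * (L + s) ^ (d - 1)) * exp (- (real d * (M + s))) * (c / w)"
      using ab L \<open>0 < w\<close> \<open>0 < q\<close> cw
      by (intro mult_right_mono mult_left_mono mult_nonneg_nonneg zero_le_power) (auto simp: s_def)
    also have "\<dots> = ?C * (real d * (L + s) ^ (d - 1)) * exp (- (real d * (M + s))) * ((M + s) - (L + s))"
      by (simp add: M)
    also have "\<dots> \<le> erlang d (M + s) - erlang d (L + s)"
      using L M cw \<open>0 < w\<close> \<open>0 < q\<close> by (intro erlang_increment_ge d) (auto simp: s_def)
    finally show "?C * (real d * (L + s) ^ (d - 1)) * (exp (- (real d * L)) * exp (- (2 * real d * (q / w + q)))) * (c / w)
       \<le> erlang d (M + s) - erlang d (L + s)" .
  qed (use \<open>0 < w\<close> \<open>0 < q\<close> in auto)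
  finally have "?C * (a ^ d - b ^ d) * (\<delta> ^ d / c ^ d)
      \<le> (1 + q) ^ d * (1 + 3 * w) * exp (2 * real d * (q / w + q)) * (erlang d (M + s) - erlang d (L + s))" .
  moreover have "\<delta> ^ d * cov_bound i = ?C * (a ^ d - b ^ d) * (\<delta> ^ d / c ^ d)"
    unfolding a_def b_def M_def L_def c_def by simp
  ultimately show ?thesis
    unfolding M_def L_def s_def by simp
qed

lemma sh_c_ge_of_K_le:
  assumes "K \<le> sh_L d \<delta> i"
  shows "q / 2 \<le> sh_c d \<delta> i"
proof -
  have "q / 2 \<le> q / (1 + q)"
    using q_pos q1 by (intro divide_left_mono) auto
  also have "\<dots> \<le> ln (1 + q)"
    using q_pos by (intro ln_one_plus_ge) simp
  also have "\<dots> \<le> sh_c d \<delta> i"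
    using q_pos assms \<delta> unfolding sh_c_def by (intro ln_mono) (auto simp: q intro!: add_pos_pos)
  finally show ?thesis .
qed

text \<open>The subtracted power is dropped, and \<open>L\<^sub>i\<^sub>+\<^sub>1\<close> and both \<open>c\<^sub>i\<close> in the other power are bounded by
  \<open>T\<close>, which gives \<open>3 T\<close>; the remaining factor 2 comes from \<open>c\<^sub>i \<ge> q / 2\<close>.\<close>

lemma cov_bound_coarse:
  assumes "K \<le> sh_L d \<delta> i" "\<delta> \<le> 1 / 2"
  shows "\<delta> ^ d * cov_bound i \<le> real d ^ d / fact d * (6 * \<delta> * sh_T d \<delta> / q) ^ d"
proof -
  define L M c where "L = sh_L d \<delta> i" and "M = sh_L d \<delta> (Suc i)" and "c = sh_c d \<delta> i"
  let ?C = "real d ^ d / fact d"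
  have cq: "q / 2 \<le> c" unfolding c_def by (rule sh_c_ge_of_K_le[OF assms(1)])
  have c: "0 < c" unfolding c_def by (rule sh_c_pos[OF d \<delta>])
  define T where "T = sh_T d \<delta>"
  have "0 < T" unfolding T_def by (rule sh_T_pos[OF d \<delta>])
  have "c \<le> T" unfolding c_def T_def by (rule sh_c_le_T[OF assms(2)])
  moreover have "M \<le> T" unfolding M_def T_def by (rule sh_L_le[OF d \<delta>])
  moreover have "0 \<le> M" unfolding M_def by (rule sh_L_nonneg[OF d \<delta>])
  ultimately have M: "0 \<le> M + 2 * c" "M + 2 * c \<le> 3 * T" using c by auto
  have "(M + 2 * c) * \<delta> / c \<le> (3 * T) * \<delta> / (q / 2)"
    using M cq q_pos \<delta> \<open>0 < T\<close> by (intro frac_le mult_right_mono mult_nonneg_nonneg) auto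
  also have "\<dots> = 6 * \<delta> * T / q" by simp
  finally have ratio: "((M + 2 * c) * \<delta> / c) ^ d \<le> (6 * \<delta> * T / q) ^ d"
    using M c \<delta> by (intro power_mono) auto
  have "\<delta> ^ d * cov_bound i = ?C * ((M + 2 * c) ^ d - max 0 (L - c) ^ d) * (\<delta> ^ d / c ^ d)"
    unfolding M_def L_def c_def by simp
  also have "\<dots> \<le> ?C * (M + 2 * c) ^ d * (\<delta> ^ d / c ^ d)"
    using c \<delta> by (intro mult_right_mono mult_left_mono) auto
  also have "\<dots> = ?C * ((M + 2 * c) * \<delta> / c) ^ d"
    by (simp add: power_mult_distrib power_divide)
  also have "\<dots> \<le> ?C * (6 * \<delta> * T / q) ^ d"
    by (intro mult_left_mono ratio) auto
  finally show ?thesis unfolding T_def .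
qed

text \<open>Each layer is charged to three nonnegative quantities that can be summed: an increment of the
  translated distribution function, which accounts for a fine step; a multiple of
  \<open>L\<^sub>i\<^sub>+\<^sub>1 - L\<^sub>i\<close>, which is at least one coarse bound when a coarse step is not cut off; and one
  coarse bound for the last step, which may be cut off to an arbitrarily short one. The first two
  telescope.\<close>

lemma B_cov_sh_le:
  assumes "\<delta> \<le> 1 / 2"
  shows "\<delta> ^ d * real (B_cov_sh d \<delta>)
    \<le> real d * \<delta> ^ d + (1 + q) ^ d * (1 + 3 * w) * exp (2 * real d * (q / w + q))
      + real d ^ d / fact d * (6 * \<delta> * sh_T d \<delta> / q) ^ d * (sh_T d \<delta> * (2 * w / q) + 1)"
proof -
  define s where "s = q / w + 2 * q"
  define A where "A = (1 + q) ^ d * (1 + 3 * w) * exp (2 * real d * (q / w + q))"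
  define R where "R = real d ^ d / fact d * (6 * \<delta> * sh_T d \<delta> / q) ^ d"
  have s: "0 \<le> s" using w_pos q_pos by (simp add: s_def)
  have A: "0 \<le> A" using w_pos q_pos by (simp add: A_def)
  have R: "0 \<le> R" using q_pos \<delta> sh_T_pos[OF d \<delta>] by (simp add: R_def)
  let ?L = "sh_L d \<delta>"
  let ?J = "sh_J d \<delta>"
  have step: "\<delta> ^ d * real (card (sh_A d \<delta> i \<union> map Suc ` sh_A d \<delta> i))
      \<le> A * (erlang d (?L (Suc i) + s) - erlang d (?L i + s))
        + R * (2 * w / q) * (?L (Suc i) - ?L i) + R * of_bool (Suc i = ?J)"
    if "i < ?J" for i
  proof -
    have F: "0 \<le> A * (erlang d (?L (Suc i) + s) - erlang d (?L i + s))"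
      using A sh_L_nonneg[OF d \<delta>, of i] sh_L_mono[OF d \<delta>, of i] s
      by (intro mult_nonneg_nonneg) (auto intro!: erlang_mono d)
    have G: "0 \<le> R * (2 * w / q) * (?L (Suc i) - ?L i)"
      using R w_pos q_pos sh_L_mono[OF d \<delta>, of i] by simp
    have H: "0 \<le> R * of_bool (Suc i = ?J)" using R by simp
    have "\<delta> ^ d * real (card (sh_A d \<delta> i \<union> map Suc ` sh_A d \<delta> i)) \<le> \<delta> ^ d * cov_bound i"
      using \<delta> by (intro mult_left_mono card_sh_A_cov_le[OF d \<delta>]) auto
    also have "\<dots> \<le> A * (erlang d (?L (Suc i) + s) - erlang d (?L i + s))
        + R * (2 * w / q) * (?L (Suc i) - ?L i) + R * of_bool (Suc i = ?J)"
    proof (cases "?L i \<le> K")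
      case True
      show ?thesis
        using cov_bound_fine[OF True] G H unfolding A_def[symmetric] s_def[symmetric] by linarith
    next
      case False
      then have K': "K \<le> ?L i" by simp
      have "R \<le> R * (2 * w / q) * (?L (Suc i) - ?L i) + R * of_bool (Suc i = ?J)"
      proof (cases "Suc i = ?J")
        case True
        then show ?thesis using G by simp
      next
        case False
        then have "?L (Suc i) - ?L i = sh_c d \<delta> i / w"
          using sh_L_Suc_untruncated[OF d \<delta>, of i] that w by simp
        then have "1 \<le> (2 * w / q) * (?L (Suc i) - ?L i)"
          using sh_c_ge_of_K_le[OF K'] w_pos q_pos by (simp add: field_simps)
        from mult_left_mono[OF this R]
        have "R \<le> R * (2 * w / q) * (?L (Suc i) - ?L i)"
          by (simp only: mult.assoc mult_1_right)
        then show ?thesis using H by linarith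
      qed
      then show ?thesis
        using cov_bound_coarse[OF K' assms] F unfolding R_def[symmetric] by linarith
    qed
    finally show ?thesis .
  qed
  have linear_sum: "(\<Sum>i<n. a * f i + b * g i + c * h i)
      = a * (\<Sum>i<n. f i) + b * (\<Sum>i<n. g i) + c * (\<Sum>i<n. h i)"
    for a b c :: real and f g h :: "nat \<Rightarrow> real" and n
    by (simp add: sum.distrib sum_distrib_left)
  have erlang_sum: "(\<Sum>i<?J. erlang d (?L (Suc i) + s) - erlang d (?L i + s)) \<le> 1"
    using sum_increments_J[OF d \<delta>, of "\<lambda>x. erlang d (x + s)"] erlang_le_1[of "sh_T d \<delta> + s" d]
      erlang_mono[OF d, of 0 s] erlang_0[OF d] s sh_T_pos[OF d \<delta>] by simp
  have L_sum: "(\<Sum>i<?J. ?L (Suc i) - ?L i) = sh_T d \<delta>"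
    using sum_increments_J[OF d \<delta>, of "\<lambda>x. x"] by simp
  have last_sum: "(\<Sum>i<?J. of_bool (Suc i = ?J)) \<le> (1 :: real)"
  proof (cases ?J)
    case (Suc m)
    have "(\<Sum>i<Suc m. of_bool (Suc i = Suc m)) = (\<Sum>i<Suc m. if i = m then 1 else 0 :: real)"
      by (rule sum.cong[OF refl]) simp
    then show ?thesis unfolding Suc by (simp add: sum.delta del: sum.lessThan_Suc)
  qed simp
  have "(\<Sum>i<?J. \<delta> ^ d * real (card (sh_A d \<delta> i \<union> map Suc ` sh_A d \<delta> i)))
    \<le> (\<Sum>i<?J. A * (erlang d (?L (Suc i) + s) - erlang d (?L i + s))
        + R * (2 * w / q) * (?L (Suc i) - ?L i) + R * of_bool (Suc i = ?J))"
    by (rule sum_mono) (use step in simp)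
  also have "\<dots> = A * (\<Sum>i<?J. erlang d (?L (Suc i) + s) - erlang d (?L i + s))
     + R * (2 * w / q) * (\<Sum>i<?J. ?L (Suc i) - ?L i) + R * (\<Sum>i<?J. of_bool (Suc i = ?J))"
    by (rule linear_sum)
  also have "\<dots> \<le> A * 1 + R * (2 * w / q) * sh_T d \<delta> + R * 1"
    unfolding L_sum
    by (rule add_mono[OF add_mono[OF mult_left_mono[OF erlang_sum A] order_refl] mult_left_mono[OF last_sum R]])
  also have "\<dots> = A + R * (sh_T d \<delta> * (2 * w / q) + 1)"
    by (simp only: distrib_left mult_1_right mult.commute mult.left_commute add.assoc)
  finally show ?thesis
    unfolding A_def[symmetric] R_def[symmetric]
    by (simp add: B_cov_sh_def sum_distrib_left distrib_left)
qed

end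
end

section \<open>The limit\<close>

lemma relative_error_existsI:
  fixes B :: "real \<Rightarrow> nat"
  assumes "((\<lambda>\<delta>. \<delta> ^ d * real (B \<delta>)) \<longlongrightarrow> 1) (at_right 0)"
  shows "\<exists>\<epsilon> :: real \<Rightarrow> real. (\<epsilon> \<longlongrightarrow> 0) (at_right 0) \<and>
    (\<forall>\<delta>. 0 < \<delta> \<and> \<delta> < 1 \<longrightarrow> real (B \<delta>) = (1 + \<epsilon> \<delta>) * \<delta> powi (- int d))"
proof (intro exI conjI allI impI)
  show "((\<lambda>\<delta>. \<delta> ^ d * real (B \<delta>) - 1) \<longlongrightarrow> 0) (at_right 0)"
    using tendsto_diff[OF assms tendsto_const[of 1]] by simp
  show "real (B \<delta>) = (1 + (\<delta> ^ d * real (B \<delta>) - 1)) * \<delta> powi (- int d)" if "0 < \<delta> \<and> \<delta> < 1" for \<delta> :: real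
    using that by (simp add: power_int_minus)
qed

lemma erlang_sh_T_tendsto:
  assumes "d \<ge> 1"
  shows "((\<lambda>\<delta>. erlang d (sh_T d \<delta>)) \<longlongrightarrow> 1) (at_right 0)"
proof (rule filterlim_compose[OF erlang_tendsto])
  have "0 < real d" using assms by simp
  then show "filterlim (\<lambda>\<delta>. sh_T d \<delta>) at_top (at_right 0)"
    by real_asymp
qed

text \<open>The exponent \<open>3 / 4\<close> puts \<open>q\<close> strictly between \<open>\<delta>\<close> and \<open>\<surd>\<delta>\<close>: it must be \<open>o(\<surd>\<delta>)\<close> for the
  fine steps to be short, and far above \<open>\<delta>\<close> for the coarse layers to be negligible.\<close>

definition cov_upper :: "nat \<Rightarrow> real \<Rightarrow> real" where
  "cov_upper d \<delta> = (let q = \<delta> powr (3 / 4); w = sqrt (real d * \<delta>) in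
     real d * \<delta> ^ d + (1 + q) ^ d * (1 + 3 * w) * exp (2 * real d * (q / w + q))
      + real d ^ d / fact d * (6 * \<delta> * sh_T d \<delta> / q) ^ d * (sh_T d \<delta> * (2 * w / q) + 1))"

lemma cov_upper_tendsto:
  assumes "d \<ge> 2"
  shows "(cov_upper d \<longlongrightarrow> 1) (at_right 0)"
proof -
  define D where "D = real d"
  have D: "0 < D" using assms by (simp add: D_def)
  \<comment> \<open>The coarse part is \<open>u\<^sup>d v\<close>, where \<open>u\<close> is of order \<open>\<delta>\<^sup>1\<^sup>/\<^sup>4\<close> and \<open>v\<close> of order \<open>\<delta>\<^sup>-\<^sup>1\<^sup>/\<^sup>4\<close> up to
  logarithms. Two factors \<open>u\<close> make \<open>u\<^sup>2 v\<close> vanish, and the remaining \<open>u\<^sup>d\<^sup>-\<^sup>2\<close> is bounded.\<close>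
  define q w u v where "q = (\<lambda>\<delta>::real. \<delta> powr (3 / 4))" and "w = (\<lambda>\<delta>. sqrt (D * \<delta>))"
    and "u = (\<lambda>\<delta>. 6 * \<delta> * (D * ln (inverse \<delta>)) / q \<delta>)"
    and "v = (\<lambda>\<delta>. D * ln (inverse \<delta>) * (2 * w \<delta> / q \<delta>) + 1)"
  have lims: "(q \<longlongrightarrow> 0) (at_right 0)" "(w \<longlongrightarrow> 0) (at_right 0)"
    "((\<lambda>\<delta>. q \<delta> / w \<delta>) \<longlongrightarrow> 0) (at_right 0)" "(u \<longlongrightarrow> 0) (at_right 0)"
    "((\<lambda>\<delta>. u \<delta> ^ 2 * v \<delta>) \<longlongrightarrow> 0) (at_right 0)"
    using D unfolding q_def w_def u_def v_def by real_asymp+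
  have id: "((\<lambda>\<delta>::real. \<delta>) \<longlongrightarrow> 0) (at_right 0)"
    by (rule tendsto_ident_at)
  have limit: "((\<lambda>\<delta>. D * \<delta> ^ d + (1 + q \<delta>) ^ d * (1 + 3 * w \<delta>) * exp (2 * D * (q \<delta> / w \<delta> + q \<delta>))
      + D ^ d / fact d * (u \<delta> ^ (d - 2) * (u \<delta> ^ 2 * v \<delta>)))
     \<longlongrightarrow> D * 0 ^ d + (1 + 0) ^ d * (1 + 3 * 0) * exp (2 * D * (0 + 0)) + D ^ d / fact d * (0 ^ (d - 2) * 0)) (at_right 0)"
    by (intro tendsto_intros lims id)
  have power_split: "u \<delta> ^ (d - 2) * (u \<delta> ^ 2 * v \<delta>) = u \<delta> ^ d * v \<delta>" for \<delta>
  proof -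
    have "u \<delta> ^ (d - 2) * u \<delta> ^ 2 = u \<delta> ^ d"
      using assms by (simp only: power_add[symmetric] le_add_diff_inverse2)
    then show ?thesis by (simp only: mult.assoc[symmetric])
  qed
  have "cov_upper d = (\<lambda>\<delta>. D * \<delta> ^ d + (1 + q \<delta>) ^ d * (1 + 3 * w \<delta>) * exp (2 * D * (q \<delta> / w \<delta> + q \<delta>))
      + D ^ d / fact d * (u \<delta> ^ (d - 2) * (u \<delta> ^ 2 * v \<delta>)))"
    unfolding power_split
    by (rule ext) (simp add: cov_upper_def Let_def q_def w_def u_def v_def D_def)
  then show ?thesis
    using limit assms by (simp add: zero_power)
qed

lemma eventually_B_cov_sh_le:
  assumes "d \<ge> 1"
  shows "eventually (\<lambda>\<delta>. \<delta> ^ d * real (B_cov_sh d \<delta>) \<le> cov_upper d \<delta>) (at_right 0)"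
proof -
  define D where "D = real d"
  have D: "0 < D" "1 \<le> D" using assms by (simp_all add: D_def)
  have "eventually (\<lambda>\<delta>. \<delta> powr (3 / 4) / sqrt (D * \<delta>) \<le> 1) (at_right 0)"
    "eventually (\<lambda>\<delta>::real. 4 \<le> ln (inverse \<delta>)) (at_right 0)"
    "eventually (\<lambda>\<delta>::real. \<delta> \<le> 1 / 2) (at_right 0)"
    "eventually (\<lambda>\<delta>::real. 0 < \<delta>) (at_right 0)"
    using D by real_asymp+
  then show ?thesis
  proof eventually_elim
    case (elim \<delta>)
    have small: "0 < \<delta>" "\<delta> < 1" using elim by auto
    \<comment> \<open>At this level \<open>\<delta> e\<^sup>L\<close> has the value \<open>\<delta>\<^sup>3\<^sup>/\<^sup>4\<close>.\<close>
    let ?K = "ln (inverse \<delta>) / 4"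
    have "\<delta> powr (3 / 4) = exp (ln \<delta> + ?K)"
      using small by (simp add: powr_def ln_inverse)
    then have q: "\<delta> powr (3 / 4) = \<delta> * exp ?K"
      using small by (simp add: exp_add)
    have "1 * ln (inverse \<delta>) \<le> D * ln (inverse \<delta>)"
      using elim by (intro mult_right_mono D) linarith
    then have K: "?K + \<delta> powr (3 / 4) / sqrt (real d * \<delta>) \<le> sh_T d \<delta>"
      using elim unfolding D_def by linarith
    have "\<delta> powr (3 / 4) \<le> 1"
      using small by (simp add: powr_le1)
    from B_cov_sh_le[OF assms small refl q this K] elim show ?case
      by (simp add: cov_upper_def Let_def)
  qed
qed

theorem corollary5p9:
  fixes d :: nat
  assumes "d \<ge> 2"
  shows "(\<exists>\<epsilon> :: real \<Rightarrow> real. (\<epsilon> \<longlongrightarrow> 0) (at_right 0) \<and>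
            (\<forall>\<delta>. 0 < \<delta> \<and> \<delta> < 1 \<longrightarrow>
               real (B_bracket_sh d \<delta>) = (1 + \<epsilon> \<delta>) * \<delta> powi (- int d)))
       \<and> (\<exists>\<epsilon> :: real \<Rightarrow> real. (\<epsilon> \<longlongrightarrow> 0) (at_right 0) \<and>
            (\<forall>\<delta>. 0 < \<delta> \<and> \<delta> < 1 \<longrightarrow>
               real (B_cov_sh d \<delta>) = (1 + \<epsilon> \<delta>) * \<delta> powi (- int d)))"
proof -
  have d: "d \<ge> 1" using assms by simp
  have "eventually (\<lambda>\<delta>::real. \<delta> \<in> {0<..<1}) (at_right 0)"
    by (rule eventually_at_right_real) simp
  then have chain: "eventually (\<lambda>\<delta>. erlang d (sh_T d \<delta>) \<le> \<delta> ^ d * real (B_bracket_sh d \<delta>)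
      \<and> \<delta> ^ d * real (B_bracket_sh d \<delta>) \<le> \<delta> ^ d * real (B_cov_sh d \<delta>)
      \<and> \<delta> ^ d * real (B_cov_sh d \<delta>) \<le> cov_upper d \<delta>) (at_right 0)"
    using eventually_B_cov_sh_le[OF d]
  proof eventually_elim
    case (elim \<delta>)
    then show ?case
      using B_bracket_sh_ge[OF d, of \<delta>] B_bracket_sh_le_B_cov_sh[of d \<delta>]
      by (auto intro!: mult_left_mono)
  qed
  have "((\<lambda>\<delta>. \<delta> ^ d * real (B_bracket_sh d \<delta>)) \<longlongrightarrow> 1) (at_right 0)"
    by (rule tendsto_sandwich[OF _ _ erlang_sh_T_tendsto[OF d] cov_upper_tendsto[OF assms]];
        use chain in eventually_elim) auto
  moreover have "((\<lambda>\<delta>. \<delta> ^ d * real (B_cov_sh d \<delta>)) \<longlongrightarrow> 1) (at_right 0)"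
    by (rule tendsto_sandwich[OF _ _ erlang_sh_T_tendsto[OF d] cov_upper_tendsto[OF assms]];
        use chain in eventually_elim) auto
  ultimately show ?thesis
    by (intro conjI relative_error_existsI)
qed

end
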